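(* Let $p$ be a prime power. Then $$z_{p^2+p+1}=\frac{p+1}{p^2+p+1}\qquad\text{and}\qquad z_{p^2+p}=\frac1p.$$
   Context: Given an edge-coloring $c$ (an arbitrary assignment of colors to edges) of the complete graph $K_n$, let $z(n,c,s)$ be the fraction of the $n$ vertices that are incident with at least one edge of color $s$, and let $z(n,c)$ be the maximum of $z(n,c,s)$ over all colors $s$ appearing in $c$. Let $z_k(n)$ be the minimum of $z(n,c)$ over all edge-colorings $c$ of $K_n$ that use at most $k$ colors, and let $z_k=\inf_{n\ge 2} z_k(n)$. *)

theory Defs
  imports Complex_Main "HOL-Library.Ramsey" "HOL-Number_Theory.Prime_Powers"
begin

text \<open>
  The complete graph on \<open>n\<close> vertices has vertex set \<open>{..<n}\<close> and edge set \<open>nsets {..<n} 2\<close>.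
  An edge-coloring is a function \<open>c :: nat set \<Rightarrow> nat\<close>, of which only the values on the
  edges matter; since there are finitely many edges, natural numbers suffice as colors.
\<close>

definition z_color :: "nat \<Rightarrow> (nat set \<Rightarrow> nat) \<Rightarrow> nat \<Rightarrow> real" where
  "z_color n c s = real (card {v \<in> {..<n}. \<exists>e \<in> nsets {..<n} 2. v \<in> e \<and> c e = s}) / real n"

definition z_coloring :: "nat \<Rightarrow> (nat set \<Rightarrow> nat) \<Rightarrow> real" where
  "z_coloring n c = Max (z_color n c ` (c ` nsets {..<n} 2))"

text \<open>
  The set of colorings is infinite (values off the edges are arbitrary), but the set of values
  minimized below is finite, and it is nonempty for \<open>k \<ge> 1\<close>, so \<open>Min\<close> is a genuine minimum
  (see \<open>finite_z_values\<close> and \<open>z_values_nonempty\<close>).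
\<close>

definition z_min :: "nat \<Rightarrow> nat \<Rightarrow> real" where
  "z_min k n = Min {z_coloring n c | c :: nat set \<Rightarrow> nat. card (c ` nsets {..<n} 2) \<le> k}"

definition z_inf :: "nat \<Rightarrow> real" where
  "z_inf k = (INF n \<in> {2..}. z_min k n)"

lemma finite_edges: "finite (nsets {..<n::nat} 2)"
  by (simp add: finite_imp_finite_nsets)

lemma edges_nonempty:
  fixes n :: nat
  assumes "n \<ge> 2"
  shows "nsets {..<n} 2 \<noteq> {}"
proof -
  have "{0, 1} \<in> nsets {..<n} 2"
    using assms by (auto simp: nsets_def)
  then show ?thesis by blast
qed

lemma finite_z_values:
  fixes n k :: nat
  assumes "n \<ge> 2"
  shows "finite {z_coloring n c | c :: nat set \<Rightarrow> nat. card (c ` nsets {..<n} 2) \<le> k}"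
proof (rule finite_subset)
  show "{z_coloring n c | c :: nat set \<Rightarrow> nat. card (c ` nsets {..<n} 2) \<le> k}
        \<subseteq> (\<lambda>m. real m / real n) ` {..n}"
  proof clarify
    fix c :: "nat set \<Rightarrow> nat"
    have "z_coloring n c \<in> z_color n c ` (c ` nsets {..<n} 2)"
      unfolding z_coloring_def
      by (rule Max_in) (use finite_edges edges_nonempty[OF assms] in auto)
    then obtain s where s: "z_coloring n c = z_color n c s" by blast
    have "card {v \<in> {..<n}. \<exists>e \<in> nsets {..<n} 2. v \<in> e \<and> c e = s} \<le> card {..<n}"
      by (rule card_mono) auto
    then show "z_coloring n c \<in> (\<lambda>m. real m / real n) ` {..n}"
      unfolding s z_color_def by auto
  qed
qed simp

lemma z_values_nonempty:
  fixes n k :: nat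
  assumes "k \<ge> 1"
  shows "{z_coloring n c | c :: nat set \<Rightarrow> nat. card (c ` nsets {..<n} 2) \<le> k} \<noteq> {}"
proof -
  have "card ((\<lambda>_. 0 :: nat) ` nsets {..<n} 2) \<le> k"
    using assms by (simp add: image_constant_conv)
  then show ?thesis by blast
qed

end

theory Submission
  imports Defs "HOL-Algebra.Algebraic_Closure" "HOL-Number_Theory.Residues"
begin

text \<open>
  Both equalities compare one counting bound with one construction.

  Lower bound. Let \<open>c\<close> color the edges of \<open>K\<^sub>n\<close> with at most \<open>k\<close> colors and let \<open>z\<close> be the
  largest fraction of vertices met by a color. The colors met by a vertex \<open>v\<close> must reach all
  \<open>n - 1\<close> other vertices, and each of them reaches at most \<open>z n - 1\<close>. So if \<open>z < 1 / p\<close>, then \<open>v\<close>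
  meets more than \<open>p\<close>, hence at least \<open>p + 1\<close>, colors. Counting pairs of a vertex and a color met by
  it in two ways gives \<open>n (p + 1) \<le> k z n\<close>. Therefore \<open>z \<ge> min (1 / p) ((p + 1) / k)\<close>
  (\<open>z_coloring_ge\<close>). For \<open>k = p\<^sup>2 + p\<close> the two terms of the minimum coincide; for
  \<open>k = p\<^sup>2 + p + 1\<close> the second one is smaller.

  Upper bound. A family of at most \<open>k\<close> sets of size at most \<open>m\<close> such that any two of \<open>n\<close> points lie
  in a common set yields a coloring: color an edge by a set that contains both ends
  (\<open>z_min_le_of_cover\<close>). The lines of an affine plane of order \<open>p\<close> have \<open>p\<close> of its \<open>p\<^sup>2\<close> points and
  there are \<open>p\<^sup>2 + p\<close> of them; adding the line at infinity gives the projective plane, where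
  \<open>p\<^sup>2 + p + 1\<close> lines have \<open>p + 1\<close> of the \<open>p\<^sup>2 + p + 1\<close> points. In both cases \<open>m / n\<close> is the lower
  bound.

  The plane is the coordinate plane over a field with \<open>p\<close> elements (\<open>affine_plane_over_field\<close>).
  That field exists because \<open>p = r ^ j\<close> for a prime \<open>r\<close>: in the algebraic closure of the integers
  modulo \<open>r\<close>, the solutions of \<open>x ^ p = x\<close> form a subfield, since the Frobenius map is additive,
  and there are exactly \<open>p\<close> of them, since \<open>X ^ p - X\<close> has no multiple roots
  (\<open>card_frobenius_fixed\<close>, \<open>finite_field_exists\<close>).
\<close>

section \<open>Double counting and the lower bound\<close>

lemma z_coloring_le_iff:
  assumes "n \<ge> 2"
  shows "z_coloring n c \<le> r \<longleftrightarrow> (\<forall>s\<in>c ` nsets {..<n} 2. z_color n c s \<le> r)"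
  unfolding z_coloring_def
  using finite_edges[of n] edges_nonempty[OF assms] by (subst Max_le_iff) auto

text \<open>
  An edge is colored by a set that contains both its ends, so the vertices met by the color of a
  set all lie in that set. Points in several common sets may be assigned any of them.
\<close>
lemma z_min_le_of_cover:
  fixes V :: "'p set" and B :: "'b set" and A :: "'b \<Rightarrow> 'p set"
  assumes V: "finite V" "card V = n" "n \<ge> 2" and B: "finite B" "card B \<le> k"
    and size: "\<And>b. b \<in> B \<Longrightarrow> finite (A b) \<and> card (A b) \<le> m"
    and cover: "\<And>x y. x \<in> V \<Longrightarrow> y \<in> V \<Longrightarrow> x \<noteq> y \<Longrightarrow> \<exists>b\<in>B. x \<in> A b \<and> y \<in> A b"
  shows "z_min k n \<le> real m / real n"
proof -
  obtain g where g: "bij_betw g {..<n} V"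
    using V ex_bij_betw_nat_finite[of V] by (auto simp: atLeast0LessThan)
  obtain h :: "'b \<Rightarrow> nat" where h: "inj_on h B"
    using B(1) finite_imp_inj_to_nat_seg by blast
  have "\<exists>b\<in>B. g ` e \<subseteq> A b" if edge: "e \<in> nsets {..<n} 2" for e
  proof -
    obtain u v where e: "e = {u, v}" "u < n" "v < n" "u \<noteq> v"
      using edge by (elim nsets2_E) auto
    have "g u \<in> V" "g v \<in> V" "g u \<noteq> g v"
      using g e by (auto simp: bij_betw_def inj_on_def)
    then show ?thesis using cover[of "g u" "g v"] e by auto
  qed
  then obtain l where l: "\<And>e. e \<in> nsets {..<n} 2 \<Longrightarrow> l e \<in> B \<and> g ` e \<subseteq> A (l e)"
    by metis
  define c where "c e = h (l e)" for e
  have "card (c ` nsets {..<n} 2) \<le> card (h ` B)"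
    using l B by (intro card_mono) (auto simp: c_def)
  also have "\<dots> \<le> k" using B card_image_le[of B h] by linarith
  finally have k: "card (c ` nsets {..<n} 2) \<le> k" .
  have "z_color n c s \<le> real m / real n" if s: "s \<in> c ` nsets {..<n} 2" for s
  proof -
    obtain b where b: "b \<in> B" "s = h b"
      using s l by (auto simp: c_def)
    let ?W = "{v \<in> {..<n}. \<exists>e\<in>nsets {..<n} 2. v \<in> e \<and> c e = s}"
    have "g ` ?W \<subseteq> A b"
    proof
      fix x assume "x \<in> g ` ?W"
      then obtain v e where v: "x = g v" "e \<in> nsets {..<n} 2" "v \<in> e" "c e = s" by auto
      then have "l e = b"
        using h l[of e] b by (auto simp: c_def inj_on_def)
      then show "x \<in> A b" using v l[of e] by auto
    qed
    then have "card (g ` ?W) \<le> card (A b)"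
      using size[OF b(1)] by (intro card_mono) auto
    moreover have "card (g ` ?W) = card ?W"
      using g by (intro card_image) (auto simp: bij_betw_def inj_on_def)
    ultimately have "card ?W \<le> m"
      using size[OF b(1)] by linarith
    then show ?thesis by (simp add: z_color_def divide_right_mono)
  qed
  then have "z_coloring n c \<le> real m / real n"
    using V by (simp add: z_coloring_le_iff)
  moreover have "z_min k n \<le> z_coloring n c"
    unfolding z_min_def using k finite_z_values[OF V(3), of k] by (intro Min_le) auto
  ultimately show ?thesis by linarith
qed

text \<open>
  The parameter \<open>p\<close> is the threshold for the number of colors met by each vertex: below \<open>1 / p\<close>,
  the colors met by a single vertex are too small for \<open>p\<close> of them to reach everything else.
\<close>
lemma z_coloring_ge:
  fixes n p k :: nat
  assumes n: "n \<ge> 2" and p: "p \<ge> 1" and k: "k \<ge> 1" and c: "card (c ` nsets {..<n} 2) \<le> k"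
  shows "min (1 / real p) ((real p + 1) / real k) \<le> z_coloring n c"
proof (cases "z_coloring n c < 1 / real p")
  case False
  then show ?thesis by linarith
next
  case True
  define z where "z = z_coloring n c"
  define C where "C = c ` nsets {..<n} 2"
  define A where "A s = {v \<in> {..<n}. \<exists>e\<in>nsets {..<n} 2. v \<in> e \<and> c e = s}" for s
  have finC: "finite C" by (simp add: C_def finite_edges)
  have finA: "finite (A s)" for s by (simp add: A_def)
  have pz: "real p * z < 1"
    using True p by (simp add: z_def field_simps)
  have A_le: "real (card (A s)) \<le> z * real n" if "s \<in> C" for s
  proof -
    have "z_color n c s \<le> z"
      using z_coloring_le_iff[OF n, of c z] that unfolding z_def C_def by blast
    then show ?thesis
      using n by (simp add: z_color_def A_def field_simps)
  qed
  have degree: "p + 1 \<le> card {s \<in> C. v \<in> A s}" if v: "v < n" for v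
  proof (rule ccontr)
    define S where "S = {s \<in> C. v \<in> A s}"
    assume "\<not> p + 1 \<le> card {s \<in> C. v \<in> A s}"
    then have S_le: "card S \<le> p" by (simp add: S_def)
    have finS: "finite S" using finC by (simp add: S_def)
    \<comment> \<open>Every other vertex is reached from \<open>v\<close> along an edge, whose color meets both ends.\<close>
    have "{..<n} - {v} \<subseteq> (\<Union>s\<in>S. A s - {v})"
    proof
      fix w assume w: "w \<in> {..<n} - {v}"
      then have e: "{v, w} \<in> nsets {..<n} 2" using v by (auto simp: nsets_def)
      then have "c {v, w} \<in> S" "w \<in> A (c {v, w}) - {v}"
        using v w by (auto simp: S_def C_def A_def)
      then show "w \<in> (\<Union>s\<in>S. A s - {v})" by blast
    qed
    then have "card ({..<n} - {v}) \<le> card (\<Union>s\<in>S. A s - {v})"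
      using finS finA by (intro card_mono) auto
    also have "\<dots> \<le> (\<Sum>s\<in>S. card (A s - {v}))"
      using finS by (rule card_UN_le)
    finally have "real (n - 1) \<le> (\<Sum>s\<in>S. real (card (A s - {v})))"
      using v by (simp flip: of_nat_sum)
    also have "\<dots> \<le> (\<Sum>s\<in>S. z * real n - 1)"
    proof (rule sum_mono)
      fix s assume s: "s \<in> S"
      then have "card (A s) = Suc (card (A s - {v}))"
        using finA by (intro card.remove) (auto simp: S_def)
      then show "real (card (A s - {v})) \<le> z * real n - 1"
        using A_le[of s] s by (simp add: S_def)
    qed
    finally have le: "real n - 1 \<le> real (card S) * (z * real n - 1)"
      using n by (simp add: of_nat_diff)
    moreover have "0 < real n - 1" using n by simp
    ultimately have "0 < real (card S) * (z * real n - 1)" by linarith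
    \<comment> \<open>This factor has to be positive before \<open>card S\<close> can be replaced by its bound \<open>p\<close>.\<close>
    then have "0 < z * real n - 1"
      by (simp add: zero_less_mult_iff)
    then have "real (card S) * (z * real n - 1) \<le> real p * (z * real n - 1)"
      using S_le by (intro mult_right_mono) auto
    also have "\<dots> = real p * z * real n - real p" by (simp add: algebra_simps)
    also have "\<dots> < real n - 1"
    proof -
      have "real p * z * real n < 1 * real n"
        using pz n by (intro mult_strict_right_mono) auto
      then show ?thesis using p by linarith
    qed
    finally show False using le by linarith
  qed
  \<comment> \<open>Count the pairs of a vertex and a color met by it, first by vertices, then by colors.\<close>
  have "real n * (real p + 1) = (\<Sum>v<n. real (p + 1))" by simp
  also have "\<dots> \<le> (\<Sum>v<n. real (card {s \<in> C. v \<in> A s}))"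
    using degree by (intro sum_mono of_nat_mono) auto
  also have "\<dots> = (\<Sum>v<n. \<Sum>s\<in>C. if v \<in> A s then 1 else 0)"
    using finC by (simp add: sum.If_cases Int_def)
  also have "\<dots> = (\<Sum>s\<in>C. \<Sum>v<n. if v \<in> A s then 1 else 0)"
    by (rule sum.swap)
  also have "\<dots> = (\<Sum>s\<in>C. real (card (A s)))"
  proof (rule sum.cong)
    fix s
    have "{..<n} \<inter> {v. v \<in> A s} = A s" by (auto simp: A_def)
    then show "(\<Sum>v<n. if v \<in> A s then 1 else 0) = real (card (A s))"
      by (simp add: sum.If_cases)
  qed simp
  also have "\<dots> \<le> (\<Sum>s\<in>C. z * real n)"
    using A_le by (rule sum_mono)
  also have "\<dots> = real (card C) * (z * real n)" by simp
  also have "\<dots> \<le> real k * (z * real n)"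
  proof -
    obtain s where "s \<in> C" using edges_nonempty[OF n] by (auto simp: C_def)
    then have "0 \<le> z * real n" using A_le[of s] by (meson of_nat_0_le_iff order_trans)
    then show ?thesis using c by (intro mult_right_mono) (auto simp: C_def)
  qed
  finally have "real n * (real p + 1) \<le> real n * (real k * z)" by (simp add: mult_ac)
  then have "real p + 1 \<le> real k * z"
    using n by (simp add: mult_le_cancel_left)
  then have "(real p + 1) / real k \<le> z"
    using k by (simp add: field_simps)
  then show ?thesis by (simp add: z_def)
qed

lemma z_min_ge:
  fixes n p k :: nat
  assumes "n \<ge> 2" "p \<ge> 1" "k \<ge> 1"
  shows "min (1 / real p) ((real p + 1) / real k) \<le> z_min k n"
  unfolding z_min_def
  using finite_z_values[OF assms(1)] z_values_nonempty[OF assms(3)] z_coloring_ge[OF assms]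
  by (subst Min_ge_iff) auto

text \<open>
  The lower bound is the same for all \<open>n\<close>, so a single \<open>n\<close> attaining it settles the infimum.
\<close>
lemma z_inf_eqI:
  fixes n p k :: nat
  assumes n: "n \<ge> 2" and p: "p \<ge> 1" and k: "k \<ge> 1"
    and r: "r = min (1 / real p) ((real p + 1) / real k)" and le: "z_min k n \<le> r"
  shows "z_inf k = r"
proof (rule antisym)
  have lower: "r \<le> z_min k n'" if "n' \<in> {2..}" for n'
    using z_min_ge[of n' p k] that p k r by simp
  then have "bdd_below (z_min k ` {2..})" by (rule bdd_belowI2)
  then have "z_inf k \<le> z_min k n"
    unfolding z_inf_def using n by (intro cINF_lower) auto
  with le show "z_inf k \<le> r" by linarith
  show "r \<le> z_inf k"
    unfolding z_inf_def using lower by (intro cINF_greatest) auto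
qed

section \<open>Colorings from affine and projective planes\<close>

text \<open>
  Lines are represented through their parallel classes: \<open>T\<close> is the set of classes, the lines of each
  class are labeled by \<open>I\<close>, and \<open>f t x\<close> is the label of the line of class \<open>t\<close> through \<open>x\<close>. The set
  \<open>T\<close> then also serves as the line at infinity. The count \<open>card_line\<close> together with
  \<open>card_points\<close> and \<open>joined\<close> forces two points to have exactly one line in common.
\<close>
locale affine_plane =
  fixes q :: nat and P :: "'p set" and T :: "'t set" and I :: "'i set" and f :: "'t \<Rightarrow> 'p \<Rightarrow> 'i"
  assumes finite: "finite P" "finite T" "finite I"
    and order: "q \<ge> 2"
    and card_points: "card P = q\<^sup>2"
    and card_classes: "card T = q + 1"
    and card_class: "card I = q"
    and line_in_class: "t \<in> T \<Longrightarrow> x \<in> P \<Longrightarrow> f t x \<in> I"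
    and card_line: "t \<in> T \<Longrightarrow> i \<in> I \<Longrightarrow> card {x \<in> P. f t x = i} = q"
    and joined: "x \<in> P \<Longrightarrow> y \<in> P \<Longrightarrow> x \<noteq> y \<Longrightarrow> \<exists>t\<in>T. f t x = f t y"
begin

lemma z_min_affine: "z_min (q\<^sup>2 + q) (q\<^sup>2) \<le> 1 / real q"
proof -
  have "z_min (q\<^sup>2 + q) (q\<^sup>2) \<le> real q / real (q\<^sup>2)"
  proof (rule z_min_le_of_cover[where V = P and B = "T \<times> I" and A = "\<lambda>(t, i). {x \<in> P. f t x = i}"])
    show "2 \<le> q\<^sup>2" using order power_increasing[of 1 2 q] by simp
    show "card (T \<times> I) \<le> q\<^sup>2 + q"
      by (simp add: card_cartesian_product card_classes card_class power2_eq_square)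
    show "\<exists>b\<in>T \<times> I. x \<in> (case b of (t, i) \<Rightarrow> {x \<in> P. f t x = i}) \<and>
        y \<in> (case b of (t, i) \<Rightarrow> {x \<in> P. f t x = i})" if xy: "x \<in> P" "y \<in> P" "x \<noteq> y" for x y
    proof -
      obtain t where "t \<in> T" "f t x = f t y" using joined[OF xy] by blast
      then show ?thesis using xy line_in_class[of t x] by (intro bexI[of _ "(t, f t x)"]) auto
    qed
  qed (use finite card_points card_line in auto)
  then show ?thesis using order by (simp add: power2_eq_square)
qed

text \<open>
  The projective completion: each class \<open>t\<close> becomes a point \<open>Inr t\<close> on all lines of that class, and
  these new points form the additional line \<open>None\<close>.
\<close>
lemma z_min_projective: "z_min (q\<^sup>2 + q + 1) (q\<^sup>2 + q + 1) \<le> (real q + 1) / (real q ^ 2 + real q + 1)"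
proof -
  define V where "V = Inl ` P \<union> Inr ` T"
  define B where "B = insert None (Some ` (T \<times> I))"
  define A :: "('t \<times> 'i) option \<Rightarrow> ('p + 't) set" where
    "A b = (case b of None \<Rightarrow> Inr ` T | Some (t, i) \<Rightarrow> insert (Inr t) (Inl ` {x \<in> P. f t x = i}))" for b
  have "z_min (q\<^sup>2 + q + 1) (q\<^sup>2 + q + 1) \<le> real (q + 1) / real (q\<^sup>2 + q + 1)"
  proof (rule z_min_le_of_cover)
    show "finite V" "finite B" using finite by (auto simp: V_def B_def)
    show "card V = q\<^sup>2 + q + 1"
      using finite unfolding V_def
      by (subst card_Un_disjoint) (auto simp: card_image card_points card_classes)
    show "2 \<le> q\<^sup>2 + q + 1" using order by simp
    show "card B \<le> q\<^sup>2 + q + 1"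
      using finite by (auto simp: B_def card_insert_if card_image card_cartesian_product
          card_classes card_class power2_eq_square)
    show "finite (A b) \<and> card (A b) \<le> q + 1" if "b \<in> B" for b
      using that finite
      by (auto simp: B_def A_def card_insert_if card_image card_classes card_line)
    show "\<exists>b\<in>B. u \<in> A b \<and> v \<in> A b" if uv: "u \<in> V" "v \<in> V" "u \<noteq> v" for u v
    proof -
      have line: "Some (t, f t x) \<in> B" "Inl x \<in> A (Some (t, f t x))" "Inr t \<in> A (Some (t, f t x))"
        if "t \<in> T" "x \<in> P" for t x
        using that line_in_class by (auto simp: A_def B_def)
      consider x y where "u = Inl x" "v = Inl y" "x \<in> P" "y \<in> P" "x \<noteq> y"
        | x t where "{u, v} = {Inl x, Inr t}" "x \<in> P" "t \<in> T"
        | "u \<in> Inr ` T" "v \<in> Inr ` T"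
        using uv by (auto simp: V_def insert_commute)
      then show ?thesis
      proof cases
        case 1
        then obtain t where "t \<in> T" "f t x = f t y" using joined by blast
        then show ?thesis using 1 line by metis
      next
        case 2
        then show ?thesis using line[of t x] by (metis doubleton_eq_iff)
      next
        case 3
        then show ?thesis by (auto simp: A_def B_def)
      qed
    qed
  qed
  then show ?thesis by (simp add: add_ac)
qed

end

text \<open>
  The class \<open>None\<close> consists of the vertical lines, labeled by abscissa, and \<open>Some m\<close> of the lines
  with slope \<open>m\<close>, labeled by intercept. Division provides the slope of the line through two points
  with different abscissas.
\<close>
lemma affine_plane_over_field:
  fixes F :: "('a, 'b) ring_scheme" (structure)
  assumes "field F" and q: "card (carrier F) = q" "q \<ge> 2"
  shows "affine_plane q (carrier F \<times> carrier F) (insert None (Some ` carrier F)) (carrier F)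
    (\<lambda>t (x, y). case t of None \<Rightarrow> x | Some m \<Rightarrow> y \<ominus> m \<otimes> x)"
    (is "affine_plane q ?P ?T ?I ?f")
proof -
  interpret field F by fact
  have fin: "finite (carrier F)" using q card.infinite by fastforce
  show ?thesis
  proof
    show "finite ?P" "finite ?T" "finite ?I" using fin by auto
    show "q \<ge> 2" by fact
    show "card ?P = q\<^sup>2" using q by (simp add: card_cartesian_product power2_eq_square)
    show "card ?T = q + 1" using fin q by (simp add: card_insert_if card_image image_iff)
    show "card ?I = q" by fact
    show "?f t z \<in> ?I" if "t \<in> ?T" "z \<in> ?P" for t z using that by auto
    show "card {z \<in> ?P. ?f t z = i} = q" if t: "t \<in> ?T" and i: "i \<in> ?I" for t i
    proof (cases t)
      case None
      then have "{z \<in> ?P. ?f t z = i} = {i} \<times> carrier F" using i by auto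
      then show ?thesis using q by (simp add: card_cartesian_product)
    next
      case (Some m)
      then have m: "m \<in> carrier F" using t by auto
      have solve: "y \<ominus> m \<otimes> x = i \<longleftrightarrow> y = i \<oplus> m \<otimes> x" if "x \<in> carrier F" "y \<in> carrier F" for x y
      proof
        have "y = (y \<ominus> m \<otimes> x) \<oplus> m \<otimes> x" using that m by algebra
        also assume "y \<ominus> m \<otimes> x = i"
        finally show "y = i \<oplus> m \<otimes> x" .
      next
        have "(i \<oplus> m \<otimes> x) \<ominus> m \<otimes> x = i" using that m i by algebra
        moreover assume "y = i \<oplus> m \<otimes> x"
        ultimately show "y \<ominus> m \<otimes> x = i" by simp
      qed
      have "{z \<in> ?P. ?f t z = i} = (\<lambda>x. (x, i \<oplus> m \<otimes> x)) ` carrier F"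
        using m i Some solve by auto
      then show ?thesis using q by (simp add: card_image inj_on_def)
    qed
    show "\<exists>t\<in>?T. ?f t z = ?f t w" if zw: "z \<in> ?P" "w \<in> ?P" "z \<noteq> w" for z w
    proof -
      obtain x y x' y' where z: "z = (x, y)" "x \<in> carrier F" "y \<in> carrier F"
        and w: "w = (x', y')" "x' \<in> carrier F" "y' \<in> carrier F"
        using zw by auto
      show ?thesis
      proof (cases "x = x'")
        case True
        then show ?thesis using z w by auto
      next
        case False
        define d where "d = x \<ominus> x'"
        define m where "m = (y \<ominus> y') \<otimes> inv d"
        have d: "d \<in> Units F"
          using False z w by (auto simp: field_Units d_def)
        then have m: "m \<in> carrier F" using z w by (auto simp: m_def)
        have "m \<otimes> d = y \<ominus> y'"
          using d z w by (simp add: m_def m_assoc Units_closed)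
        then have slope: "m \<otimes> (x \<ominus> x') = y \<ominus> y'" by (simp add: d_def)
        have "y \<ominus> m \<otimes> x = y' \<oplus> (y \<ominus> y') \<ominus> m \<otimes> x"
          using z w m by algebra
        also have "\<dots> = y' \<oplus> m \<otimes> (x \<ominus> x') \<ominus> m \<otimes> x"
          by (simp only: slope)
        also have "\<dots> = y' \<ominus> m \<otimes> x'"
          using z w m by algebra
        finally have "y \<ominus> m \<otimes> x = y' \<ominus> m \<otimes> x'" .
        then show ?thesis using m z w by (intro bexI[of _ "Some m"]) auto
      qed
    qed
  qed
qed

section \<open>Finite fields of prime power order\<close>

text \<open>
  Induction by Pascal's rule: multiplying by \<open>x\<close> shifts the index, multiplying by \<open>y\<close> keeps it.
\<close>
lemma (in cring) binomial_theorem: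
  fixes n :: nat
  assumes x: "x \<in> carrier R" and y: "y \<in> carrier R"
  shows "(x \<oplus> y) [^] n = (\<Oplus>i\<in>{..n}. [(n choose i)] \<cdot> (x [^] i \<otimes> y [^] (n - i)))"
proof (induction n)
  case 0
  then show ?case using x y by simp
next
  case (Suc n)
  define f where "f m i = [(m choose i)] \<cdot> (x [^] i \<otimes> y [^] (m - i))" for m i
  have closed: "f m i \<in> carrier R" for m i
    using x y by (simp add: f_def)
  define g where "g i = [(n choose i)] \<cdot> (x [^] i \<otimes> y [^] (Suc n - i))" for i
  have g_closed: "g i \<in> carrier R" for i
    using x y by (simp add: g_def)
  have f_g: "y \<otimes> f n i = g i" if "i \<le> n" for i
    using x y that
    by (simp add: f_def g_def add_pow_rdistr Suc_diff_le m_lcomm m_comm)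
  have pascal: "f (Suc n) (Suc i) = (x \<otimes> f n i) \<oplus> g (Suc i)" for i
    using x y
    by (simp add: f_def g_def add_pow_rdistr add.nat_pow_mult[symmetric] m_ac)
  have "(x \<oplus> y) [^] Suc n = (\<Oplus>i\<in>{..n}. f n i) \<otimes> (x \<oplus> y)"
    using Suc by (simp add: f_def)
  also have "\<dots> = x \<otimes> (\<Oplus>i\<in>{..n}. f n i) \<oplus> y \<otimes> (\<Oplus>i\<in>{..n}. f n i)"
    using x y closed by (simp add: m_comm[of _ "x \<oplus> y"] l_distr)
  also have "y \<otimes> (\<Oplus>i\<in>{..n}. f n i) = (\<Oplus>i\<in>{..n}. y \<otimes> f n i)"
    using x y closed by (simp add: finsum_rdistr)
  also have "\<dots> = (\<Oplus>i\<in>{..n}. g i)"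
    using f_g g_closed by (intro finsum_cong') auto
  \<comment> \<open>The added top term has the coefficient \<open>n choose Suc n = 0\<close>.\<close>
  also have "\<dots> = (\<Oplus>i\<in>{..Suc n}. g i)"
    using g_closed by (subst finsum_Suc) (auto simp: g_def binomial_eq_0)
  also have "\<dots> = (\<Oplus>i\<in>{..n}. g (Suc i)) \<oplus> f (Suc n) 0"
    using g_closed by (subst finsum_Suc2) (auto simp: f_def g_def)
  also have "x \<otimes> (\<Oplus>i\<in>{..n}. f n i) \<oplus> ((\<Oplus>i\<in>{..n}. g (Suc i)) \<oplus> f (Suc n) 0)
      = (\<Oplus>i\<in>{..n}. f (Suc n) (Suc i)) \<oplus> f (Suc n) 0"
  proof -
    have "(\<Oplus>i\<in>{..n}. f (Suc n) (Suc i)) = (\<Oplus>i\<in>{..n}. x \<otimes> f n i) \<oplus> (\<Oplus>i\<in>{..n}. g (Suc i))"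
      unfolding pascal using x closed g_closed by (intro finsum_addf) auto
    then show ?thesis
      using x closed g_closed by (simp add: finsum_rdistr a_assoc)
  qed
  also have "\<dots> = (\<Oplus>i\<in>{..Suc n}. f (Suc n) i)"
    using closed by (subst finsum_Suc2) auto
  finally show ?case by (simp add: f_def)
qed

lemma (in cring) add_pow_char_dvd:
  fixes p m :: nat
  assumes "[p] \<cdot> \<one> = \<zero>" "p dvd m" "z \<in> carrier R"
  shows "[m] \<cdot> z = \<zero>"
proof -
  obtain k where "m = p * k" using assms(2) by auto
  then have "[m] \<cdot> z = [k] \<cdot> ([p] \<cdot> (\<one> \<otimes> z))"
    using assms(3) by (simp add: add.nat_pow_pow)
  also have "[p] \<cdot> (\<one> \<otimes> z) = \<zero>"
    using assms(1,3) add_pow_ldistr[of \<one> z p] by simp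
  finally show ?thesis by simp
qed

text \<open>
  The characteristic is stated as \<open>[p] \<cdot> \<one> = \<zero>\<close> so that this applies both to the field and to
  the polynomial ring over it. For \<open>k = 1\<close>, the prime \<open>p\<close> divides all binomial coefficients other
  than the two outer ones; the rest is iteration.
\<close>
lemma (in cring) frobenius_add:
  fixes p k :: nat
  assumes p: "Factorial_Ring.prime p" and char: "[p] \<cdot> \<one> = \<zero>"
    and x: "x \<in> carrier R" and y: "y \<in> carrier R"
  shows "(x \<oplus> y) [^] (p ^ k) = x [^] (p ^ k) \<oplus> y [^] (p ^ k)"
proof (induction k)
  case 0
  then show ?case using x y by simp
next
  case (Suc k)
  have freshman: "(a \<oplus> b) [^] p = a [^] p \<oplus> b [^] p"
    if a: "a \<in> carrier R" and b: "b \<in> carrier R" for a b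
  proof -
    obtain r where r: "p = Suc (Suc r)"
      using less_imp_Suc_add[OF prime_gt_1_nat[OF p]] by auto
    define f where "f i = [(p choose i)] \<cdot> (a [^] i \<otimes> b [^] (p - i))" for i
    have closed: "f i \<in> carrier R" for i
      using a b by (simp add: f_def)
    have middle: "f (Suc i) = \<zero>" if "i \<le> r" for i
      unfolding f_def
      by (intro add_pow_char_dvd[OF char] dvd_choose_prime) (use p a b that r in auto)
    have "(a \<oplus> b) [^] p = (\<Oplus>i\<in>{..p}. f i)"
      unfolding f_def by (rule binomial_theorem[OF a b])
    also have "\<dots> = f p \<oplus> ((\<Oplus>i\<in>{..r}. f (Suc i)) \<oplus> f 0)"
      using closed unfolding r by (subst finsum_Suc, simp, subst finsum_Suc2) auto
    also have "(\<Oplus>i\<in>{..r}. f (Suc i)) = (\<Oplus>i\<in>{..r}. \<zero>)"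
      using middle by (intro finsum_cong') auto
    finally show ?thesis using a b by (simp add: f_def)
  qed
  have "(x \<oplus> y) [^] (p ^ Suc k) = ((x \<oplus> y) [^] (p ^ k)) [^] p"
    using x y by (simp add: nat_pow_pow mult.commute)
  also have "\<dots> = (x [^] (p ^ k)) [^] p \<oplus> (y [^] (p ^ k)) [^] p"
    using Suc x y by (simp add: freshman)
  finally show ?case
    using x y by (simp add: nat_pow_pow mult.commute)
qed

lemma ring_hom_char:
  fixes n :: nat
  assumes "ring R" "ring S" "h \<in> ring_hom R S" and "[n] \<cdot>\<^bsub>R\<^esub> \<one>\<^bsub>R\<^esub> = \<zero>\<^bsub>R\<^esub>"
  shows "[n] \<cdot>\<^bsub>S\<^esub> \<one>\<^bsub>S\<^esub> = \<zero>\<^bsub>S\<^esub>"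
proof -
  interpret h: ring_hom_ring R S h
    using assms by (intro ring_hom_ringI2)
  have "h ([m] \<cdot>\<^bsub>R\<^esub> \<one>\<^bsub>R\<^esub>) = [m] \<cdot>\<^bsub>S\<^esub> \<one>\<^bsub>S\<^esub>" for m :: nat
    by (induction m) simp_all
  from this[of n] show ?thesis using assms(4) by simp
qed

lemma (in cring) frobenius_diff:
  fixes p k :: nat
  assumes "Factorial_Ring.prime p" "[p] \<cdot> \<one> = \<zero>" "x \<in> carrier R" "y \<in> carrier R"
  shows "(x \<ominus> y) [^] (p ^ k) = x [^] (p ^ k) \<ominus> y [^] (p ^ k)"
proof -
  have "((x \<ominus> y) \<oplus> y) [^] (p ^ k) = (x \<ominus> y) [^] (p ^ k) \<oplus> y [^] (p ^ k)"
    using assms by (intro frobenius_add) auto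
  moreover have "(x \<ominus> y) \<oplus> y = x" using assms by algebra
  moreover have "u \<ominus> v = w" if "u = w \<oplus> v" "u \<in> carrier R" "v \<in> carrier R" "w \<in> carrier R"
    for u v w using that by (simp add: a_minus_def a_assoc r_neg)
  ultimately show ?thesis using assms by (metis minus_closed nat_pow_closed)
qed

text \<open>
  The fixed points are the roots of \<open>X ^ q - X\<close> with \<open>q = p ^ k\<close>, which splits, so it remains to show
  that no root \<open>a\<close> is multiple. Formal derivatives are avoided by a shift: as \<open>a ^ q = a\<close>,
  additivity of the Frobenius map in the polynomial ring shows that with \<open>Y = X - a\<close> also
  \<open>Y ^ q - Y = X ^ q - X\<close>. If \<open>Y\<^sup>2\<close> divided this, then \<open>Y\<close> would divide \<open>1\<close>.
\<close>
lemma (in algebraically_closed) card_frobenius_fixed: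
  fixes p k :: nat
  assumes p: "Factorial_Ring.prime p" and char: "[p] \<cdot> \<one> = \<zero>" and k: "k > 0"
  shows "card {x \<in> carrier L. x [^] (p ^ k) = x} = p ^ k"
proof -
  define q where "q = p ^ k"
  have q: "q > 1" unfolding q_def using one_less_power[OF prime_gt_1_nat[OF p] k] .
  define UP where "UP = poly_ring L"
  interpret UP: domain UP
    unfolding UP_def by (rule univ_poly_is_domain[OF carrier_is_subring])
  have const: "poly_of_const \<in> ring_hom L UP"
    using canonical_embedding_is_hom[OF carrier_is_subring] by (simp add: UP_def)
  then interpret C: ring_hom_ring L UP poly_of_const
    by (intro ring_hom_ringI2) (auto simp: ring_axioms UP.ring_axioms)
  have charUP: "[p] \<cdot>\<^bsub>UP\<^esub> \<one>\<^bsub>UP\<^esub> = \<zero>\<^bsub>UP\<^esub>"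
    by (rule ring_hom_char[OF ring_axioms UP.ring_axioms const char])
  have X: "X \<in> carrier UP"
    using var_closed(1)[OF carrier_is_subring] by (simp add: UP_def)
  define f where "f = X [^]\<^bsub>UP\<^esub> q \<ominus>\<^bsub>UP\<^esub> X"
  have f: "f \<in> carrier UP" using X by (simp add: f_def)
  have deg: "degree f = q"
  proof -
    have "degree (X [^]\<^bsub>UP\<^esub> q) = q"
      using polynomial_pow_degree[of X q] X by (simp add: UP_def var_def)
    moreover have "degree (\<ominus>\<^bsub>UP\<^esub> X) = 1"
      using univ_poly_a_inv_degree[OF carrier_is_subring, of X] X by (simp add: UP_def var_def)
    moreover have "f = poly_add (X [^]\<^bsub>UP\<^esub> q) (\<ominus>\<^bsub>UP\<^esub> X)"
      unfolding f_def a_minus_def UP_def by (simp add: univ_poly_add)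
    moreover have "polynomial (carrier L) (X [^]\<^bsub>UP\<^esub> q)" "polynomial (carrier L) (\<ominus>\<^bsub>UP\<^esub> X)"
      using X UP.nat_pow_closed UP.a_inv_closed by (auto simp: UP_def univ_poly_carrier)
    ultimately show ?thesis
      using q poly_add_degree_eq[OF carrier_is_subring, of "X [^]\<^bsub>UP\<^esub> q" "\<ominus>\<^bsub>UP\<^esub> X"] by simp
  qed
  then have f0: "f \<noteq> []" using q by auto
  have root_iff: "is_root f a \<longleftrightarrow> a \<in> carrier L \<and> a [^] q = a" for a
  proof (cases "a \<in> carrier L")
    case a: True
    have ev: "(\<lambda>g. eval g a) \<in> ring_hom UP L"
      using eval_is_hom[OF carrier_is_subring a] by (simp add: UP_def)
    then interpret E: ring_hom_ring UP L "\<lambda>g. eval g a"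
      by (intro ring_hom_ringI2) (auto simp: ring_axioms UP.ring_axioms)
    have "eval f a = a [^] q \<ominus> a"
      using X a by (simp add: f_def a_minus_def eval_var E.hom_nat_pow)
    then show ?thesis
      using a f0 unfolding is_root_def by auto
  qed (simp add: is_root_def)
  have simple: "alg_mult f a \<le> 1" if "is_root f a" for a
  proof (rule ccontr)
    assume "\<not> alg_mult f a \<le> 1"
    then have two: "2 \<le> alg_mult f a" by simp
    have a: "a \<in> carrier L" "a [^] q = a" using that root_iff by auto
    define Y where "Y = [\<one>, \<ominus> a]"
    have Y: "Y \<in> carrier UP"
      using a unfolding Y_def UP_def sym[OF univ_poly_carrier] polynomial_def by auto
    have YX: "Y = X \<ominus>\<^bsub>UP\<^esub> poly_of_const a"
    proof -
      have "X \<ominus>\<^bsub>UP\<^esub> poly_of_const a = X \<oplus>\<^bsub>UP\<^esub> poly_of_const (\<ominus> a)"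
        using a by (simp add: a_minus_def)
      also have "\<dots> = Y"
        using a by (simp add: UP_def univ_poly_add Y_def var_def poly_of_const_def)
      finally show ?thesis by simp
    qed
    have "Y [^]\<^bsub>UP\<^esub> q \<ominus>\<^bsub>UP\<^esub> Y = f"
    proof -
      have "Y [^]\<^bsub>UP\<^esub> q = X [^]\<^bsub>UP\<^esub> q \<ominus>\<^bsub>UP\<^esub> poly_of_const a [^]\<^bsub>UP\<^esub> q"
        unfolding YX q_def by (rule UP.frobenius_diff[OF p charUP X]) (simp add: a)
      also have "poly_of_const a [^]\<^bsub>UP\<^esub> q = poly_of_const a"
        using C.hom_nat_pow[of a q] a by simp
      finally have "Y [^]\<^bsub>UP\<^esub> q = X [^]\<^bsub>UP\<^esub> q \<ominus>\<^bsub>UP\<^esub> poly_of_const a" .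
      moreover have "(u \<ominus>\<^bsub>UP\<^esub> w) \<ominus>\<^bsub>UP\<^esub> (v \<ominus>\<^bsub>UP\<^esub> w) = u \<ominus>\<^bsub>UP\<^esub> v"
        if "u \<in> carrier UP" "v \<in> carrier UP" "w \<in> carrier UP" for u v w
        using that by algebra
      ultimately show ?thesis
        using X a by (simp add: YX f_def)
    qed
    moreover have "Y [^]\<^bsub>UP\<^esub> (2::nat) divides\<^bsub>UP\<^esub> f"
      using le_alg_mult_imp_pdivides[OF a(1) _ two] f by (simp add: UP_def Y_def pdivides_def)
    ultimately obtain g where g: "g \<in> carrier UP"
      "Y [^]\<^bsub>UP\<^esub> q \<ominus>\<^bsub>UP\<^esub> Y = Y [^]\<^bsub>UP\<^esub> (2::nat) \<otimes>\<^bsub>UP\<^esub> g"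
      by (auto simp: factor_def)
    obtain r where r: "q = Suc (Suc r)"
      using less_imp_Suc_add[OF q] by auto
    let ?h = "Y [^]\<^bsub>UP\<^esub> r \<ominus>\<^bsub>UP\<^esub> g"
    have h: "?h \<in> carrier UP" using Y g by simp
    have "Y \<otimes>\<^bsub>UP\<^esub> (Y \<otimes>\<^bsub>UP\<^esub> ?h) = Y \<otimes>\<^bsub>UP\<^esub> \<one>\<^bsub>UP\<^esub>"
    proof -
      have cancel: "u \<ominus>\<^bsub>UP\<^esub> v = Y" if "u \<ominus>\<^bsub>UP\<^esub> Y = v" "u \<in> carrier UP" for u v
        using that(2) Y unfolding that(1)[symmetric] by algebra
      have "Y \<otimes>\<^bsub>UP\<^esub> (Y \<otimes>\<^bsub>UP\<^esub> ?h) = Y [^]\<^bsub>UP\<^esub> q \<ominus>\<^bsub>UP\<^esub> Y [^]\<^bsub>UP\<^esub> (2::nat) \<otimes>\<^bsub>UP\<^esub> g"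
        using Y g(1) unfolding r numeral_2_eq_2
        by (simp add: a_minus_def UP.r_distr UP.r_minus UP.m_ac)
      also have "\<dots> = Y" using g(2) Y by (intro cancel) auto
      finally show ?thesis using Y by simp
    qed
    moreover have "Y \<noteq> \<zero>\<^bsub>UP\<^esub>" by (simp add: Y_def UP_def univ_poly_zero)
    ultimately have "Y \<otimes>\<^bsub>UP\<^esub> ?h = \<one>\<^bsub>UP\<^esub>"
      using UP.m_lcancel[OF _ Y, of "Y \<otimes>\<^bsub>UP\<^esub> ?h" "\<one>\<^bsub>UP\<^esub>"] Y h by simp
    then have "Y pdivides \<one>\<^bsub>UP\<^esub>"
      using h unfolding pdivides_def UP_def factor_def by metis
    then have "degree Y \<le> degree \<one>\<^bsub>UP\<^esub>"
      using pdivides_imp_degree_le[OF carrier_is_subring, of Y "\<one>\<^bsub>UP\<^esub>"] Y UP.one_closed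
      by (simp add: UP_def univ_poly_one)
    then show False by (simp add: Y_def UP_def univ_poly_one)
  qed
  have fL: "f \<in> carrier (poly_ring L)" using f by (simp add: UP_def)
  have "{x \<in> carrier L. x [^] q = x} = set_mset (roots f)"
    using root_iff roots_mem_iff_is_root[OF fL] by auto
  also have "card \<dots> = size (roots f)"
  proof -
    have "count (roots f) a = 1" if "a \<in># roots f" for a
      using that simple[of a] alg_mult_eq_count_roots[OF fL] roots_mem_iff_is_root[OF fL]
      by (metis count_eq_zero_iff le_antisym less_one linorder_not_less)
    then show ?thesis by (simp add: size_multiset_overloaded_eq)
  qed
  also have "\<dots> = q"
    using roots_over_carrier[OF fL] deg by (simp add: splitted_def)
  finally show ?thesis by (simp add: q_def)
qed

text \<open>
  The field consists of the fixed points of \<open>x \<mapsto> x ^ q\<close> in the algebraic closure of the integers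
  modulo a prime, whose elements have this type. Additivity of the Frobenius map closes them under
  sums and negatives, multiplicativity under products and inverses.
\<close>
lemma finite_field_exists:
  assumes "primepow q"
  shows "\<exists>F :: ((int list \<times> nat) multiset \<Rightarrow> int) ring. field F \<and> card (carrier F) = q"
proof -
  obtain p k where p: "Factorial_Ring.prime p" and k: "k > 0" and q: "q = p ^ k"
    using assms by (auto simp: primepow_def)
  let ?R = "residue_ring (int p)"
  interpret R: residues_prime p ?R
    by unfold_locales (fact p)
  interpret R: field ?R by (rule R.is_field)
  define L where "L = R.alg_closure"
  interpret L: algebraic_closure L "R.indexed_const ` carrier ?R"
    unfolding L_def by (rule R.alg_closureE)
  have "[n] \<cdot>\<^bsub>?R\<^esub> \<one>\<^bsub>?R\<^esub> = int n mod int p" for n :: nat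
    by (induction n) (simp_all add: R.res_zero_eq R.res_one_eq R.res_add_eq mod_simps add.commute)
  from this[of p] have "[p] \<cdot>\<^bsub>?R\<^esub> \<one>\<^bsub>?R\<^esub> = \<zero>\<^bsub>?R\<^esub>" by (simp add: R.res_zero_eq)
  then have char: "[p] \<cdot>\<^bsub>L\<^esub> \<one>\<^bsub>L\<^esub> = \<zero>\<^bsub>L\<^esub>"
    using ring_hom_char[OF R.ring_axioms L.ring_axioms] R.alg_closureE(2) L_def by blast
  define K where "K = {x \<in> carrier L. x [^]\<^bsub>L\<^esub> q = x}"
  have card: "card K = q"
    unfolding K_def q using L.card_frobenius_fixed[OF p char k] by simp
  have "subfield K L"
  proof (rule L.subfieldI')
    show "subring K L"
    proof (rule L.subringI)
      show "x \<oplus>\<^bsub>L\<^esub> y \<in> K" if "x \<in> K" "y \<in> K" for x y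
        using that L.frobenius_add[OF p char] by (simp add: K_def q)
      show "x \<otimes>\<^bsub>L\<^esub> y \<in> K" if "x \<in> K" "y \<in> K" for x y
        using that by (simp add: K_def L.nat_pow_distrib)
      show "\<ominus>\<^bsub>L\<^esub> x \<in> K" if "x \<in> K" for x
        using that L.frobenius_diff[OF p char, of "\<zero>\<^bsub>L\<^esub>" x k] p
        by (simp add: K_def q a_minus_def L.nat_pow_zero)
    qed (auto simp: K_def)
    show "inv\<^bsub>L\<^esub> x \<in> K" if "x \<in> K - {\<zero>\<^bsub>L\<^esub>}" for x
    proof -
      have x: "x \<in> carrier L" "x [^]\<^bsub>L\<^esub> q = x" "x \<in> Units L"
        using that by (auto simp: K_def L.field_Units)
      have "x [^]\<^bsub>L\<^esub> q \<otimes>\<^bsub>L\<^esub> inv\<^bsub>L\<^esub> x [^]\<^bsub>L\<^esub> q = (x \<otimes>\<^bsub>L\<^esub> inv\<^bsub>L\<^esub> x) [^]\<^bsub>L\<^esub> q"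
        using x by (simp only: L.nat_pow_distrib[OF _ L.Units_inv_closed])
      also have "\<dots> = \<one>\<^bsub>L\<^esub>"
        using x by simp
      finally have "x \<otimes>\<^bsub>L\<^esub> inv\<^bsub>L\<^esub> x [^]\<^bsub>L\<^esub> q = \<one>\<^bsub>L\<^esub>"
        by (simp only: x(2))
      then have "inv\<^bsub>L\<^esub> x = inv\<^bsub>L\<^esub> x [^]\<^bsub>L\<^esub> q"
        using x by (intro L.comm_inv_char) auto
      then show ?thesis
        using x by (simp add: K_def)
    qed
  qed
  then have "field (L\<lparr>carrier := K\<rparr>)"
    by (rule L.subfield_iff(2))
  with card show ?thesis by (intro exI[of _ "L\<lparr>carrier := K\<rparr>"]) simp
qed

section \<open>The values of the infimum\<close>

theorem proposition2p6:
  fixes p :: nat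
  assumes "primepow p"
  shows "z_inf (p^2 + p + 1) = (real p + 1) / (real p ^ 2 + real p + 1) \<and>
         z_inf (p^2 + p) = 1 / real p"
proof -
  obtain F :: "((int list \<times> nat) multiset \<Rightarrow> int) ring"
    where F: "field F" "card (carrier F) = p"
    using finite_field_exists[OF assms] by blast
  have p: "p \<ge> 2" using primepow_gt_Suc_0[OF assms] by simp
  interpret affine_plane p "carrier F \<times> carrier F" "insert None (Some ` carrier F)" "carrier F"
    "\<lambda>t (x, y). case t of None \<Rightarrow> x | Some m \<Rightarrow> y \<ominus>\<^bsub>F\<^esub> m \<otimes>\<^bsub>F\<^esub> x"
    by (rule affine_plane_over_field[OF F p])
  have n: "p\<^sup>2 \<ge> 2" using p power_increasing[of 1 2 p] by simp
  have projective: "z_inf (p\<^sup>2 + p + 1) = (real p + 1) / (real p ^ 2 + real p + 1)"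
  proof (rule z_inf_eqI[OF _ _ _ _ z_min_projective])
    have "(real p + 1) / (real p ^ 2 + real p + 1) \<le> 1 / real p"
      using p by (simp add: divide_simps power2_eq_square add_pos_pos algebra_simps)
    then show "(real p + 1) / (real p ^ 2 + real p + 1)
        = min (1 / real p) ((real p + 1) / real (p\<^sup>2 + p + 1))"
      by (simp add: add_ac)
  qed (use n p in auto)
  have affine: "z_inf (p\<^sup>2 + p) = 1 / real p"
  proof (rule z_inf_eqI[OF _ _ _ _ z_min_affine])
    have "real (p\<^sup>2 + p) = real p * (real p + 1)"
      by (simp add: power2_eq_square algebra_simps)
    then have "(real p + 1) / real (p\<^sup>2 + p) = 1 / real p"
      using p by simp
    then show "1 / real p = min (1 / real p) ((real p + 1) / real (p\<^sup>2 + p))"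
      by simp
  qed (use n p in auto)
  show ?thesis using projective affine by blast
qed

end
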